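(* Let $z^*=(x^*,y^* )$ be an optimal solution (global minimizer) of the problem $\min\{f(z):z\in F\}$ and let $B:=\mathscr{A}\times_2x^*\in\mathbb{R}^{l\times n}$. If $\nabla_{\gamma_{x^*}}f(z^* )=0$ and $$L>\max\left\{\lambda_{\max}(B^\top B),\ \max_{i\in I_1\setminus\Gamma_1^*}\frac{|\nabla_if(z^* )|}{M_s(|x^*|)}\right\},$$ then $z^*$ is an $L$-like stationary point of this problem, and $\bar{\mathbf P}_F(z^*-\nabla f(z^* )/L)$ is a singleton; thus $\bar{\mathbf P}_F(z^*-\nabla f(z^* )/L)=\{z^*\}$.
   Context: $l,m,n,s,t$ are positive integers with $s<m$, $t<n$; $\mathscr{A}=(a_{ijk})\in\mathbb{R}^{l\times m\times n}$ and $b\in\mathbb{R}^l$ are given. For $x\in\mathbb{R}^m$, $y\in\mathbb{R}^n$: $(\mathscr{A}\times_2x)_{ik}=\sum_ja_{ijk}x_j$, $(\mathscr{A}xy)_i=\sum_{j,k}a_{ijk}x_jy_k$, and $f(z)=f(x,y)=\frac12\|\mathscr{A}xy-b\|^2$ for $z=(x,y)\in\mathbb{R}^{m+n}$; $\nabla_if$ is the $i$-th component of $\nabla f$. $I=\{1,\dots,m+n\}$, $I_1=\{1,\dots,m\}$, $I_2=\{m+1,\dots,m+n\}$; coordinates of $y$ are indexed by $I_2$. $\Gamma_1^*=\{i\in I_1:z_i^*\ne0\}$. $\lambda_{\max}(S)$ for symmetric $S$ is the largest absolute value of an eigenvalue of $S$. $|x|$ is the entrywise absolute value and $M_i(v)$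 is the value of the $i$-th largest entry of $v$. If $M_s(|x^*|)=0$, a quotient $0/0$ is read as $0$ (and $c/0$ with $c>0$ as $+\infty$). $\|\cdot\|_0$ counts nonzero entries. For $x\ne0$, $\gamma_x$ is the index of the first nonzero entry of $x$. $F_1=\{x\in\mathbb{R}^m:\|x\|_0\le s,\ e_{\gamma_x}^\top x=1\}$ (nonzero vectors with at most $s$ nonzero entries and first nonzero entry equal to $1$), $F_2=\{y\in\mathbb{R}^n:\|y\|_0\le t\}$, $F=F_1\times F_2$. Like-projection: for $z=(x,y)\in\mathbb{R}^{m+n}$ define $\psi_z$ by: if $x=0$, $\psi_z(u)=u$; if $x\ne0$, $(\psi_z(u))_i=x_{\gamma_u^z}u_i$ for $i\in I_1$ and $(\psi_z(u))_i=u_i/x_{\gamma_u^z}$ for $i\in I_2$, where $\gamma_u^z:=\min\{i\in I_1:u_i\ne0,\ z_i\ne0\}$. The like-projection of $z$ onto $F$ is the set $\bar{\mathbf P}_F(z)=\arg\min_{u\in F}\|\psi_z(u)-z\|^2$, the minimum being over those $u\in F$ for which $\psi_z(u)$ is defined (for $x\ne0$, those for which the index set defining $\gamma_u^z$ is nonempty). For $L>0$, $z^*=(x^*,y^* )\in F$ is an $L$-like stationary point if $z^*\in\bar{\mathbf P}_F(z^*-\nabla f(z^* )/L)$ and $\nabla_{\gamma_{x^*}}f(z^* )=0$. *)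

theory Defs
  imports "HOL-Analysis.Analysis"
begin

text \<open>
  A tensor in $R^{l \times m \times n}$ has type \<open>real^'n^'m^'l\<close> with $a_{ijk}$ being
  \<open>A $ i $ j $ k\<close>, and $R^{m+n}$ is \<open>(real^'m) \<times> (real^'n)\<close> with its Euclidean
  (product) inner product.  The index type \<open>'m\<close> carries a linear order (it then is a copy of
  $1 < \dots < m$) because the first nonzero entry of a vector has to make sense.
\<close>

type_synonym ('m, 'n) point = "(real^'m) \<times> (real^'n)"

definition tensor_mult2 ::
    "real^'n^'m^'l \<Rightarrow> real^'m \<Rightarrow> real^'n^'l" where
  "tensor_mult2 A x = (\<chi> i k. \<Sum>j\<in>UNIV. A $ i $ j $ k * x $ j)"

definition tensor_mult ::
    "real^'n^'m^'l \<Rightarrow> real^'m \<Rightarrow> real^'n \<Rightarrow> real^'l" where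
  "tensor_mult A x y = (\<chi> i. \<Sum>j\<in>UNIV. \<Sum>k\<in>UNIV. A $ i $ j $ k * x $ j * y $ k)"

definition objective ::
    "real^'n^'m^'l \<Rightarrow> real^'l \<Rightarrow> (real^'m) \<times> (real^'n) \<Rightarrow> real" where
  "objective A b z = (1/2) * (norm (tensor_mult A (fst z) (snd z) - b))\<^sup>2"

definition gradient :: "('a::real_inner \<Rightarrow> real) \<Rightarrow> 'a \<Rightarrow> 'a" where
  "gradient f z = (THE D. GDERIV f z :> D)"

definition lambda_max :: "real^'n^'n \<Rightarrow> real" where
  "lambda_max S = Max {\<bar>c\<bar> |c. \<exists>v. v \<noteq> 0 \<and> S *v v = c *\<^sub>R v}"

definition support :: "real^'n \<Rightarrow> 'n set" where
  "support x = {i. x $ i \<noteq> 0}"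

definition l0norm :: "real^'n \<Rightarrow> nat" where
  "l0norm x = card (support x)"

text \<open>Entries are counted with multiplicity; the position \<open>i\<close> starts at 1.\<close>

definition ith_largest :: "nat \<Rightarrow> real^'n \<Rightarrow> real" where
  "ith_largest i v =
     rev (sorted_list_of_multiset (image_mset (\<lambda>j. v $ j) (mset_set UNIV))) ! (i - 1)"

definition first_nz :: "real^('m::{finite,linorder}) \<Rightarrow> 'm" where
  "first_nz x = Min (support x)"

definition F1 :: "nat \<Rightarrow> (real^('m::{finite,linorder})) set" where
  "F1 s = {x. x \<noteq> 0 \<and> l0norm x \<le> s \<and> x $ first_nz x = 1}"

definition F2 :: "nat \<Rightarrow> (real^'n) set" where
  "F2 t = {y. l0norm y \<le> t}"

definition feasible ::
    "nat \<Rightarrow> nat \<Rightarrow> ('m::{finite,linorder}, 'n::finite) point set" where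
  "feasible s t = F1 s \<times> F2 t"

definition gamma_like ::
    "('m::{finite,linorder}, 'n::finite) point \<Rightarrow> ('m, 'n) point \<Rightarrow> 'm" where
  "gamma_like z u = Min (support (fst u) \<inter> support (fst z))"

text \<open>
  The map $\psi_z$ is partial: \<open>psi z u\<close> is meaningful only when \<open>psi_defined z u\<close> holds,
  and the like-projection below only looks at such \<open>u\<close>.
\<close>

definition psi_defined ::
    "('m::{finite,linorder}, 'n::finite) point \<Rightarrow> ('m, 'n) point \<Rightarrow> bool" where
  "psi_defined z u \<longleftrightarrow> fst z = 0 \<or> support (fst u) \<inter> support (fst z) \<noteq> {}"

definition psi ::
    "('m::{finite,linorder}, 'n::finite) point \<Rightarrow> ('m, 'n) point
       \<Rightarrow> ('m, 'n) point" where
  "psi z u =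
     (if fst z = 0 then u
      else (let c = fst z $ gamma_like z u
            in (\<chi> i. c * fst u $ i, \<chi> k. snd u $ k / c)))"

definition like_proj ::
    "('m::{finite,linorder}, 'n::finite) point set \<Rightarrow> ('m, 'n) point
       \<Rightarrow> ('m, 'n) point set" where
  "like_proj F z =
     {u. is_arg_min (\<lambda>u. (norm (psi z u - z))\<^sup>2) (\<lambda>u. u \<in> F \<and> psi_defined z u) u}"

definition like_stationary ::
    "('m::{finite,linorder}, 'n::finite) point set \<Rightarrow> (('m, 'n) point \<Rightarrow> real)
       \<Rightarrow> real \<Rightarrow> ('m, 'n) point \<Rightarrow> bool" where
  "like_stationary F f L z \<longleftrightarrow>
     L > 0 \<and> z \<in> F \<and> z \<in> like_proj F (z - (1 / L) *\<^sub>R gradient f z) \<and>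
     fst (gradient f z) $ first_nz (fst z) = 0"

text \<open>
  Division of extended reals has exactly the conventions required when the \<open>s\<close>-th largest
  entry of \<open>\<bar>x\<bar>\<close> vanishes.
\<close>

lemma ereal_quotient_conventions:
  "(0::ereal) / 0 = 0"
  "c > 0 \<Longrightarrow> ereal c / 0 = \<infinity>"
  by (simp_all add: divide_ereal_def)

end

theory Submission
  imports Defs
begin

text \<open>
  The like-projection problem at the gradient step \<open>z\<close> of \<open>(xs, ys)\<close> splits into its two blocks,
  because \<^const>\<open>psi\<close> maps a feasible point to a pair whose blocks are multiples of the original
  ones and hence as sparse as they were. It is therefore enough that \<open>xs\<close> is the only best
  \<open>s\<close>-sparse approximation of the first block of \<open>z\<close>, and \<open>ys\<close> the only best \<open>t\<close>-sparse
  approximation of the second: the map \<^const>\<open>psi\<close> fixes \<open>(xs, ys)\<close>, and no other feasible point is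
  sent there, since the first nonzero entry is normalized to 1 (\<open>like_proj_eq_singleton\<close>).

  For the second block, \<open>ys\<close> minimizes a least squares function with Gram matrix \<open>B\<^sup>T B\<close> over the
  \<open>t\<close>-sparse vectors, and \<open>L\<close> exceeds the curvature; the quadratic upper model with constant \<open>L\<close>
  then lies strictly above the function away from \<open>ys\<close>, so \<open>ys\<close> is its unique sparse minimizer
  (\<open>minimizer_snd_unique_projection\<close>).

  For the first block, the normalization of \<open>xs\<close> can be dropped, since \<open>x\<close> and \<open>y\<close> may be rescaled
  inversely without changing the objective (\<open>minimizer_le_unnormalized\<close>). So the partial
  derivatives vanish on the support of \<open>xs\<close>, and everywhere if \<open>xs\<close> has fewer than \<open>s\<close> nonzero
  entries (\<open>minimizer_partial_zero\<close>). In the latter case the gradient step does not move \<open>xs\<close>. In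
  the former it only adds entries outside the support, and the lower bound on \<open>L\<close> makes these
  smaller in absolute value than all \<open>s\<close> entries in the support, so hard thresholding recovers \<open>xs\<close>
  (\<open>hard_threshold_strict\<close>).
\<close>

section \<open>Largest eigenvalues of Gram matrices\<close>

text \<open>This is first-order optimality for quadratic polynomials. It covers both variational
  arguments below, the eigenvector equation of a Rayleigh maximizer and the vanishing of partial
  derivatives of the objective, which is exactly quadratic along coordinate lines.\<close>

lemma linear_coeff_zero_if_nonneg:
  fixes a c :: real
  assumes nonneg: "\<And>e. 0 \<le> e * a + e\<^sup>2 * c"
  shows "a = 0"
proof (rule ccontr)
  assume "a \<noteq> 0"
  define d where "d = \<bar>c\<bar> + 1"
  have "d > 0" "c - d < 0" unfolding d_def by auto
  \<comment> \<open>A step against the slope, short enough for the quadratic term not to compensate.\<close>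
  have "(- a / d) * a + (- a / d)\<^sup>2 * c = a\<^sup>2 * (c - d) / d\<^sup>2"
    using \<open>d > 0\<close> by (simp add: field_simps power2_eq_square)
  also have "\<dots> < 0"
    using \<open>a \<noteq> 0\<close> \<open>d > 0\<close> \<open>c - d < 0\<close> by (simp add: divide_neg_pos mult_pos_neg)
  finally show False using nonneg[of "- a / d"] by linarith
qed

lemma gram_inner:
  fixes B :: "real^'n^'l"
  shows "((transpose B ** B) *v u) \<bullet> v = (B *v u) \<bullet> (B *v v)"
proof -
  have "((transpose B ** B) *v u) \<bullet> v = ((B *v u) v* B) \<bullet> v"
    by (simp add: matrix_vector_mul_assoc[symmetric])
  then show ?thesis by (simp add: dot_lmul_matrix)
qed

text \<open>The eigenvalues of a Gram matrix have pairwise orthogonal eigenvectors, so there are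
  finitely many of them; this makes the maximum in \<^const>\<open>lambda_max\<close> meaningful.\<close>

lemma finite_gram_eigenvalues:
  fixes B :: "real^'n^'l"
  shows "finite {c. \<exists>v. v \<noteq> 0 \<and> (transpose B ** B) *v v = c *\<^sub>R v}" (is "finite ?E")
proof -
  define S where "S = transpose B ** B"
  have "\<forall>c\<in>?E. \<exists>v. v \<noteq> 0 \<and> S *v v = c *\<^sub>R v" unfolding S_def by auto
  then obtain ev where "\<forall>c\<in>?E. ev c \<noteq> 0 \<and> S *v ev c = c *\<^sub>R ev c"
    using bchoice by meson
  then have ev: "ev c \<noteq> 0" "S *v ev c = c *\<^sub>R ev c" if "c \<in> ?E" for c
    using that by blast+
  have ortho: "ev c \<bullet> ev d = 0" if "c \<in> ?E" "d \<in> ?E" "c \<noteq> d" for c d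
  proof -
    have "c * (ev c \<bullet> ev d) = (S *v ev c) \<bullet> ev d" using ev that by simp
    also have "\<dots> = (S *v ev d) \<bullet> ev c"
      unfolding S_def gram_inner by (rule inner_commute)
    also have "\<dots> = d * (ev c \<bullet> ev d)" using ev that by (simp add: inner_commute)
    finally show ?thesis using \<open>c \<noteq> d\<close> by simp
  qed
  have "inj_on ev ?E"
  proof (rule inj_onI)
    fix c d assume "c \<in> ?E" "d \<in> ?E" "ev c = ev d"
    then show "c = d" using ortho[of c d] ev[of c] by fastforce
  qed
  have "pairwise orthogonal (ev ` ?E)"
    unfolding pairwise_def orthogonal_def using ortho by blast
  moreover have "0 \<notin> ev ` ?E" using ev by force
  ultimately have "finite (ev ` ?E)"
    using pairwise_orthogonal_independent independent_imp_finite by blast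
  then show ?thesis using \<open>inj_on ev ?E\<close> by (rule finite_imageD)
qed

text \<open>A maximizer of \<open>v \<mapsto> \<parallel>B v\<parallel>\<close> on the unit sphere is an
  eigenvector of the Gram matrix, and the corresponding eigenvalue is the squared maximum.\<close>

lemma norm_matrix_vector_le_lambda_max:
  fixes B :: "real^'n^'l"
  shows "(norm (B *v v))\<^sup>2 \<le> lambda_max (transpose B ** B) * (norm v)\<^sup>2"
    and "0 \<le> lambda_max (transpose B ** B)"
proof -
  define S where "S = transpose B ** B"
  let ?Eig = "{c. \<exists>v. v \<noteq> 0 \<and> S *v v = c *\<^sub>R v}"
  have "axis undefined 1 \<in> sphere (0 :: real^'n) 1" by simp
  then have "sphere (0 :: real^'n) 1 \<noteq> {}" by blast
  moreover have "continuous_on (sphere 0 1) (\<lambda>v. (norm (B *v v))\<^sup>2)"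
    by (intro continuous_intros linear_continuous_on) simp
  ultimately obtain v0 where v0: "norm v0 = 1"
    and max: "\<And>v. norm v = 1 \<Longrightarrow> (norm (B *v v))\<^sup>2 \<le> (norm (B *v v0))\<^sup>2"
    using continuous_attains_sup[OF compact_sphere, of "0 :: real^'n" 1 "\<lambda>v. (norm (B *v v))\<^sup>2"]
    by auto
  define \<mu> where "\<mu> = (norm (B *v v0))\<^sup>2"
  have bound: "(norm (B *v w))\<^sup>2 \<le> \<mu> * (norm w)\<^sup>2" for w
  proof (cases "w = 0")
    case False
    have "(norm (B *v ((1 / norm w) *\<^sub>R w)))\<^sup>2 \<le> \<mu>"
      unfolding \<mu>_def using False by (intro max) simp
    then show ?thesis
      using False by (simp add: matrix_vector_mult_scaleR power_divide field_simps)
  qed simp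
  have "S *v v0 = \<mu> *\<^sub>R v0"
  proof -
    have "(\<mu> *\<^sub>R v0 - S *v v0) \<bullet> h = 0" for h
    proof -
      have "0 \<le> e * (2 * ((\<mu> *\<^sub>R v0 - S *v v0) \<bullet> h)) + e\<^sup>2 * (\<mu> * (norm h)\<^sup>2 - (norm (B *v h))\<^sup>2)"
        for e
      proof -
        have "0 \<le> \<mu> * (norm (v0 + e *\<^sub>R h))\<^sup>2 - (norm (B *v (v0 + e *\<^sub>R h)))\<^sup>2"
          using bound[of "v0 + e *\<^sub>R h"] by simp
        also have "(norm (v0 + e *\<^sub>R h))\<^sup>2 = 1 + 2 * e * (v0 \<bullet> h) + e\<^sup>2 * (norm h)\<^sup>2"
          using v0 unfolding norm_eq_1 power2_norm_eq_inner
          by (simp add: inner_add inner_commute power2_eq_square algebra_simps)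
        also have "(norm (B *v (v0 + e *\<^sub>R h)))\<^sup>2
            = \<mu> + 2 * e * ((S *v v0) \<bullet> h) + e\<^sup>2 * (norm (B *v h))\<^sup>2"
          unfolding \<mu>_def S_def gram_inner power2_norm_eq_inner
          by (simp add: matrix_vector_right_distrib matrix_vector_mult_scaleR
              inner_add inner_commute power2_eq_square algebra_simps)
        finally show ?thesis by (simp add: inner_diff_left algebra_simps)
      qed
      from linear_coeff_zero_if_nonneg[OF this] show ?thesis by simp
    qed
    then have "\<mu> *\<^sub>R v0 - S *v v0 = 0" using inner_eq_zero_iff by blast
    then show ?thesis by simp
  qed
  moreover have "v0 \<noteq> 0" using v0 by auto
  ultimately have "\<mu> \<in> ?Eig" by blast
  moreover have "finite (abs ` ?Eig)" unfolding S_def by (intro finite_imageI finite_gram_eigenvalues)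
  ultimately have "\<bar>\<mu>\<bar> \<le> Max (abs ` ?Eig)" by (intro Max_ge) auto
  also have "abs ` ?Eig = {\<bar>c\<bar> |c. \<exists>v. v \<noteq> 0 \<and> S *v v = c *\<^sub>R v}" by blast
  finally have le: "\<bar>\<mu>\<bar> \<le> lambda_max S" unfolding lambda_max_def .
  then show "0 \<le> lambda_max (transpose B ** B)" unfolding S_def by linarith
  have "\<mu> * (norm v)\<^sup>2 \<le> lambda_max S * (norm v)\<^sup>2" using le by (intro mult_right_mono) auto
  then show "(norm (B *v v))\<^sup>2 \<le> lambda_max (transpose B ** B) * (norm v)\<^sup>2"
    using bound[of v] unfolding S_def by linarith
qed

section \<open>Order statistics and best sparse approximation\<close>

lemma ith_largest_counts:
  fixes v :: "real^'n"
  assumes "0 < i" "i \<le> CARD('n)"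
  shows "i \<le> card {k. v $ k \<ge> ith_largest i v}"
    and "card {k. v $ k > ith_largest i v} < i"
proof -
  define M where "M = image_mset (\<lambda>k. v $ k) (mset_set UNIV)"
  define r where "r = rev (sorted_list_of_multiset M)"
  have len: "length r = CARD('n)"
    unfolding r_def M_def by (metis length_rev mset_sorted_list_of_multiset size_image_mset size_mset
        size_mset_set)
  have dec: "r ! q \<le> r ! p" if "p \<le> q" "q < length r" for p q
  proof -
    have "sorted (rev r)" unfolding r_def by simp
    then show ?thesis using that by (metis sorted_rev_nth_mono)
  qed
  have ith: "ith_largest i v = r ! (i - 1)" unfolding ith_largest_def r_def M_def ..
  have count: "card {k. P (v $ k)} = card {p. p < length r \<and> P (r ! p)}" for P
  proof -
    have "card {k. P (v $ k)} = size (filter_mset P M)"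
      unfolding M_def by (simp add: filter_mset_image_mset)
    also have "\<dots> = length (filter P r)"
      unfolding r_def by (metis mset_filter mset_rev mset_sorted_list_of_multiset size_mset)
    finally show ?thesis by (simp add: length_filter_conv_card)
  qed
  have "{..<i} \<subseteq> {p. p < length r \<and> r ! p \<ge> r ! (i - 1)}"
    using assms len dec by auto
  then have "card {..<i} \<le> card {p. p < length r \<and> r ! p \<ge> r ! (i - 1)}"
    by (intro card_mono) auto
  then show "i \<le> card {k. v $ k \<ge> ith_largest i v}" unfolding ith count by simp
  have "{p. p < length r \<and> r ! p > r ! (i - 1)} \<subseteq> {..<i - 1}"
    using dec by (force simp: not_less[symmetric])
  then have "card {p. p < length r \<and> r ! p > r ! (i - 1)} \<le> card {..<i - 1}"
    by (intro card_mono) auto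
  then show "card {k. v $ k > ith_largest i v} < i" unfolding ith count using assms by simp
qed

text \<open>By counting: fewer than \<open>i\<close> entries exceed the \<open>i\<close>-th largest, so it is positive; and
  the at least \<open>i\<close> entries that reach it then exhaust the support.\<close>

lemma ith_largest_abs_full_support:
  fixes x :: "real^'n"
  assumes "0 < i" "l0norm x = i"
  shows "0 < ith_largest i \<bar>x\<bar>"
    and "j \<in> support x \<Longrightarrow> ith_largest i \<bar>x\<bar> \<le> \<bar>x $ j\<bar>"
proof -
  let ?M = "ith_largest i \<bar>x\<bar>"
  have i: "i \<le> CARD('n)" using assms unfolding l0norm_def by (metis card_mono finite top_greatest)
  have counts: "i \<le> card {k. \<bar>x $ k\<bar> \<ge> ?M}" "card {k. \<bar>x $ k\<bar> > ?M} < i"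
    using ith_largest_counts[OF assms(1) i, of "\<bar>x\<bar>"] by (simp_all add: abs_vec_def)
  show pos: "0 < ?M"
  proof (rule ccontr)
    assume "\<not> 0 < ?M"
    then have "support x \<subseteq> {k. \<bar>x $ k\<bar> > ?M}" unfolding support_def by auto
    then have "card (support x) \<le> card {k. \<bar>x $ k\<bar> > ?M}" by (intro card_mono) auto
    then show False using counts(2) assms(2) unfolding l0norm_def by linarith
  qed
  have "{k. \<bar>x $ k\<bar> \<ge> ?M} \<subseteq> support x" using pos unfolding support_def by auto
  then have "{k. \<bar>x $ k\<bar> \<ge> ?M} = support x"
    using counts(1) assms(2) unfolding l0norm_def by (intro card_seteq) auto
  then show "?M \<le> \<bar>x $ j\<bar>" if "j \<in> support x" using that by blast
qed

text \<open>Charging the price \<open>\<tau>\<close> for every nonzero entry makes the problem separable. If \<open>\<tau>\<close> lies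
  between the squared entries of \<open>w\<close> off and on the support of \<open>x\<close>, then each \<open>x $ i\<close> is the
  only cheapest choice in its coordinate; since \<open>x\<close> pays the largest admissible total price, it
  is also the closest point.\<close>

lemma hard_threshold_strict:
  fixes x w u :: "real^'n"
  assumes on: "\<And>i. i \<in> support x \<Longrightarrow> w $ i = x $ i \<and> \<tau> < (w $ i)\<^sup>2"
    and off: "\<And>i. i \<notin> support x \<Longrightarrow> (w $ i)\<^sup>2 < \<tau>"
    and "0 \<le> \<tau>" and card_le: "l0norm u \<le> l0norm x" and "u \<noteq> x"
  shows "(norm (x - w))\<^sup>2 < (norm (u - w))\<^sup>2"
proof -
  define cost where "cost u i = (u $ i - w $ i)\<^sup>2 + (if u $ i = 0 then 0 else \<tau>)" for u :: "real^'n" and i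
  have total: "(\<Sum>i\<in>UNIV. cost u i) = (norm (u - w))\<^sup>2 + \<tau> * real (l0norm u)" for u
  proof -
    have "(\<Sum>i\<in>UNIV. if u $ i = 0 then 0 else \<tau>) = (\<Sum>i\<in>support u. \<tau>)"
      unfolding support_def by (intro sum.mono_neutral_cong_right) auto
    moreover have "(norm (u - w))\<^sup>2 = (\<Sum>i\<in>UNIV. (u $ i - w $ i)\<^sup>2)"
      unfolding power2_norm_eq_inner by (simp add: inner_vec_def power2_eq_square)
    ultimately show ?thesis
      unfolding cost_def l0norm_def by (simp add: sum.distrib mult.commute)
  qed
  have strict: "cost x i < cost u i" if "u $ i \<noteq> x $ i" for i
  proof (cases "i \<in> support x")
    case True
    then have "cost x i = \<tau>" using on[OF True] unfolding cost_def support_def by simp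
    moreover have "\<tau> < cost u i"
      using on[OF True] that unfolding cost_def by (cases "u $ i = 0") auto
    ultimately show ?thesis by simp
  next
    case False
    then have "x $ i = 0" by (simp add: support_def)
    then have "cost x i = (w $ i)\<^sup>2" "cost u i \<ge> \<tau>" using that unfolding cost_def by simp_all
    then show ?thesis using off[OF False] by linarith
  qed
  obtain k where "u $ k \<noteq> x $ k" using \<open>u \<noteq> x\<close> by (auto simp: vec_eq_iff)
  have "(\<Sum>i\<in>UNIV. cost x i) < (\<Sum>i\<in>UNIV. cost u i)"
  proof (rule sum_strict_mono_ex1)
    show "\<forall>i\<in>UNIV. cost x i \<le> cost u i"
      using strict unfolding cost_def by (metis order_refl less_imp_le)
    show "\<exists>i\<in>UNIV. cost x i < cost u i" using strict \<open>u $ k \<noteq> x $ k\<close> by blast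
  qed simp
  moreover have "\<tau> * real (l0norm u) \<le> \<tau> * real (l0norm x)"
    using card_le \<open>0 \<le> \<tau>\<close> by (intro mult_left_mono) auto
  ultimately show ?thesis unfolding total by linarith
qed

section \<open>The bilinear least squares objective\<close>

lemma tensor_mult_eq_tensor_mult2: "tensor_mult A x y = tensor_mult2 A x *v y"
proof -
  have "(\<Sum>j\<in>UNIV. \<Sum>k\<in>UNIV. A $ i $ j $ k * x $ j * y $ k)
      = (\<Sum>k\<in>UNIV. (\<Sum>j\<in>UNIV. A $ i $ j $ k * x $ j) * y $ k)" for i
    by (subst sum.swap) (simp add: sum_distrib_right)
  then show ?thesis
    by (simp add: tensor_mult_def tensor_mult2_def matrix_vector_mult_def)
qed

lemma bounded_bilinear_tensor_mult: "bounded_bilinear (tensor_mult A)"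
proof -
  have "linear (\<lambda>y. tensor_mult A x y)" for x
    unfolding tensor_mult_eq_tensor_mult2 by simp
  moreover have "linear (\<lambda>x. tensor_mult A x y)" for y
    by (rule linearI)
      (simp_all add: vec_eq_iff tensor_mult_def distrib_left distrib_right sum.distrib
        sum_distrib_left mult.assoc mult.left_commute[of _ "_ :: real"])
  ultimately show ?thesis
    unfolding bilinear_conv_bounded_bilinear[symmetric] bilinear_def by blast
qed

lemmas tensor_mult_bilinear_simps =
  bounded_bilinear.add_left[OF bounded_bilinear_tensor_mult]
  bounded_bilinear.add_right[OF bounded_bilinear_tensor_mult]
  bounded_bilinear.diff_right[OF bounded_bilinear_tensor_mult]
  bounded_bilinear.scaleR_left[OF bounded_bilinear_tensor_mult]
  bounded_bilinear.scaleR_right[OF bounded_bilinear_tensor_mult]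
  bounded_bilinear.zero_left[OF bounded_bilinear_tensor_mult]
  bounded_bilinear.zero_right[OF bounded_bilinear_tensor_mult]

lemma gradient_eqI:
  assumes "GDERIV f z :> D"
  shows "gradient f z = D"
  unfolding gradient_def
proof (rule the_equality)
  show "GDERIV f z :> D" by fact
  fix D' assume "GDERIV f z :> D'"
  then have "(\<lambda>h. h \<bullet> D') = (\<lambda>h. h \<bullet> D)"
    using assms unfolding gderiv_def by (rule has_derivative_unique)
  then show "D' = D" by (metis vector_eq_ldot)
qed

lemma inner_gradient_objective:
  "h \<bullet> gradient (objective A b) (x, y)
     = (tensor_mult A x y - b) \<bullet> (tensor_mult A (fst h) y + tensor_mult A x (snd h))"
proof -
  define f' where "f' h = (tensor_mult A x y - b) \<bullet> (tensor_mult A (fst h) y + tensor_mult A x (snd h))"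
    for h
  have "((\<lambda>z. tensor_mult A (fst z) (snd z) - b) has_derivative
      (\<lambda>h. tensor_mult A x (snd h) + tensor_mult A (fst h) y)) (at (x, y))"
    by (rule derivative_eq_intros bounded_bilinear.FDERIV[OF bounded_bilinear_tensor_mult] refl | simp)+
  from has_derivative_inner[OF this this]
  have "((\<lambda>z. (1/2) * ((tensor_mult A (fst z) (snd z) - b) \<bullet> (tensor_mult A (fst z) (snd z) - b)))
      has_derivative f') (at (x, y))"
    by (rule has_derivative_eq_rhs[OF has_derivative_mult_right])
      (auto simp: f'_def inner_commute add.commute)
  then have der: "(objective A b has_derivative f') (at (x, y))"
    unfolding objective_def power2_norm_eq_inner .
  then have lin: "linear f'" by (rule has_derivative_linear)
  define D where "D = (\<Sum>d\<in>Basis. f' d *\<^sub>R d)"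
  have repr: "h \<bullet> D = f' h" for h
  proof -
    have "f' (\<Sum>d\<in>Basis. (h \<bullet> d) *\<^sub>R d) = (\<Sum>d\<in>Basis. (h \<bullet> d) * f' d)"
      by (simp add: linear_sum[OF lin] linear_cmul[OF lin])
    then show ?thesis
      unfolding D_def by (simp add: euclidean_representation inner_sum_right mult.commute)
  qed
  have "GDERIV (objective A b) (x, y) :> D"
    unfolding gderiv_def repr by (rule der)
  then show ?thesis using repr by (simp add: gradient_eqI f'_def)
qed

lemma objective_expand_fst:
  "objective A b (x + h, y)
     = objective A b (x, y) + h \<bullet> fst (gradient (objective A b) (x, y))
       + (1/2) * (norm (tensor_mult A h y))\<^sup>2"
proof -
  have "h \<bullet> fst (gradient (objective A b) (x, y)) = (tensor_mult A x y - b) \<bullet> tensor_mult A h y"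
    using inner_gradient_objective[of "(h, 0)" A b x y]
    by (simp add: inner_prod_def tensor_mult_bilinear_simps)
  then show ?thesis
    unfolding objective_def
    by (simp add: tensor_mult_bilinear_simps power2_norm_eq_inner algebra_simps inner_commute)
qed

lemma objective_expand_snd:
  "objective A b (x, y + h)
     = objective A b (x, y) + h \<bullet> snd (gradient (objective A b) (x, y))
       + (1/2) * (norm (tensor_mult A x h))\<^sup>2"
proof -
  have "h \<bullet> snd (gradient (objective A b) (x, y)) = (tensor_mult A x y - b) \<bullet> tensor_mult A x h"
    using inner_gradient_objective[of "(0, h)" A b x y]
    by (simp add: inner_prod_def tensor_mult_bilinear_simps)
  then show ?thesis
    unfolding objective_def
    by (simp add: tensor_mult_bilinear_simps power2_norm_eq_inner algebra_simps inner_commute)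
qed

section \<open>Optimality over the normalized sparse pairs\<close>

lemma support_scaleR [simp]: "c \<noteq> 0 \<Longrightarrow> support (c *\<^sub>R x) = support x"
  by (simp add: support_def)

lemma l0norm_scaleR [simp]: "c \<noteq> 0 \<Longrightarrow> l0norm (c *\<^sub>R x) = l0norm x"
  by (simp add: l0norm_def)

lemma first_nz_in_support:
  assumes "x \<noteq> 0"
  shows "first_nz x \<in> support x"
  unfolding first_nz_def
proof (rule Min_in)
  show "support x \<noteq> {}" using assms by (auto simp: support_def vec_eq_iff)
qed simp

text \<open>The objective only sees \<open>tensor_mult A x y\<close>, which is unchanged when \<open>x\<close> is divided by a
  scalar and \<open>y\<close> multiplied by it. The normalization in \<^const>\<open>F1\<close> therefore costs nothing: a
  minimizer also beats the sparse pairs with arbitrary first nonzero entry.\<close>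

lemma minimizer_le_unnormalized:
  assumes opt: "is_arg_min (objective A b) (\<lambda>z. z \<in> feasible s t) (xs, ys)"
    and "x \<noteq> 0" "l0norm x \<le> s" "l0norm y \<le> t"
  shows "objective A b (xs, ys) \<le> objective A b (x, y)"
proof -
  define c where "c = x $ first_nz x"
  have "c \<noteq> 0" using first_nz_in_support[OF \<open>x \<noteq> 0\<close>] unfolding c_def support_def by simp
  then have "first_nz ((1 / c) *\<^sub>R x) = first_nz x" unfolding first_nz_def by simp
  then have "((1 / c) *\<^sub>R x, c *\<^sub>R y) \<in> feasible s t"
    using assms \<open>c \<noteq> 0\<close> c_def by (simp add: feasible_def F1_def F2_def)
  then have "objective A b (xs, ys) \<le> objective A b ((1 / c) *\<^sub>R x, c *\<^sub>R y)"
    using opt unfolding is_arg_min_def by (meson not_less)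
  then show ?thesis
    using \<open>c \<noteq> 0\<close> by (simp add: objective_def tensor_mult_bilinear_simps)
qed

text \<open>Any coordinate other than the normalized one can be moved in both directions without \<open>xs\<close>
  becoming zero, since the entry 1 stays; so only sparsity limits the move. The normalized
  coordinate is covered by the stationarity hypothesis.\<close>

lemma minimizer_partial_zero:
  assumes opt: "is_arg_min (objective A b) (\<lambda>z. z \<in> feasible s t) (xs, ys)"
    and first: "fst (gradient (objective A b) (xs, ys)) $ first_nz xs = 0"
    and sparse: "card (insert i (support xs)) \<le> s"
  shows "fst (gradient (objective A b) (xs, ys)) $ i = 0"
proof (cases "i = first_nz xs")
  case False
  have feas: "xs \<noteq> 0" "l0norm ys \<le> t" "xs $ first_nz xs = 1"
    using opt by (auto simp: is_arg_min_def feasible_def F1_def F2_def)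
  have "0 \<le> e * fst (gradient (objective A b) (xs, ys)) $ i
      + e\<^sup>2 * ((1/2) * (norm (tensor_mult A (axis i 1) ys))\<^sup>2)" for e
  proof -
    have "(xs + e *\<^sub>R axis i 1) $ first_nz xs = 1" using feas False by (simp add: axis_def)
    then have "xs + e *\<^sub>R axis i 1 \<noteq> 0" by (metis zero_index zero_neq_one)
    moreover have "support (xs + e *\<^sub>R axis i 1) \<subseteq> insert i (support xs)"
      by (auto simp: support_def axis_def)
    then have "card (support (xs + e *\<^sub>R axis i 1)) \<le> card (insert i (support xs))"
      by (intro card_mono) auto
    then have "l0norm (xs + e *\<^sub>R axis i 1) \<le> s"
      using sparse unfolding l0norm_def by linarith
    ultimately have "objective A b (xs, ys) \<le> objective A b (xs + e *\<^sub>R axis i 1, ys)"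
      using minimizer_le_unnormalized[OF opt] feas by blast
    then show ?thesis
      unfolding objective_expand_fst
      by (simp add: tensor_mult_bilinear_simps inner_axis' power_mult_distrib algebra_simps)
  qed
  then show ?thesis by (rule linear_coeff_zero_if_nonneg)
qed (use first in simp)

text \<open>Either all \<open>s\<close> entries are used, and the bound on \<open>L\<close> makes the new entries of the gradient
  step smaller than the old ones, or there is room for a further entry, and then the
  gradient vanishes.\<close>

lemma minimizer_fst_unique_projection:
  fixes A :: "real^'n^('m::{finite,linorder})^'l"
  assumes opt: "is_arg_min (objective A b) (\<lambda>z. z \<in> feasible s t) (xs, ys)"
    and first: "fst (gradient (objective A b) (xs, ys)) $ first_nz xs = 0"
    and "0 < s" "s < CARD('m)" "0 < L"
    and quot: "\<And>i. i \<notin> support xs \<Longrightarrow>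
      ereal \<bar>fst (gradient (objective A b) (xs, ys)) $ i\<bar> / ereal (ith_largest s \<bar>xs\<bar>) < ereal L"
    and w_def: "w = xs - (1 / L) *\<^sub>R fst (gradient (objective A b) (xs, ys))"
    and "l0norm u \<le> s" "u \<noteq> xs"
  shows "(norm (xs - w))\<^sup>2 < (norm (u - w))\<^sup>2"
proof -
  define g where "g = fst (gradient (objective A b) (xs, ys))"
  have w: "w $ i = xs $ i - g $ i / L" for i unfolding w_def g_def by simp
  have card_s: "card (support xs) \<le> s"
    using opt by (auto simp: is_arg_min_def feasible_def F1_def l0norm_def)
  have g_zero: "g $ i = 0" if "card (insert i (support xs)) \<le> s" for i
    using minimizer_partial_zero[OF opt first that] unfolding g_def .
  have g_on: "g $ i = 0" if "i \<in> support xs" for i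
    using g_zero[of i] card_s that by (simp add: insert_absorb)
  show ?thesis
  proof (cases "card (support xs) = s")
    case True
    define M where "M = ith_largest s \<bar>xs\<bar>"
    have full: "l0norm xs = s" using True by (simp add: l0norm_def)
    have "M > 0" unfolding M_def by (rule ith_largest_abs_full_support(1)[OF \<open>0 < s\<close> full])
    have "w $ i = xs $ i \<and> M\<^sup>2 \<le> (w $ i)\<^sup>2" if "i \<in> support xs" for i
    proof -
      have "M \<le> \<bar>xs $ i\<bar>"
        unfolding M_def by (rule ith_largest_abs_full_support(2)[OF \<open>0 < s\<close> full that])
      then have "M\<^sup>2 \<le> (xs $ i)\<^sup>2" using \<open>M > 0\<close> by (simp flip: abs_le_square_iff)
      then show ?thesis using g_on[OF that] w by simp
    qed
    moreover have small: "(w $ i)\<^sup>2 < M\<^sup>2" if "i \<notin> support xs" for i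
    proof -
      have "ereal \<bar>g $ i\<bar> / ereal M < ereal L" using quot[OF that] unfolding g_def M_def .
      then have "\<bar>g $ i\<bar> / M < L" using \<open>M > 0\<close> by simp
      then have "\<bar>g $ i / L\<bar> < \<bar>M\<bar>" using \<open>M > 0\<close> \<open>0 < L\<close> by (simp add: field_simps)
      then have "(g $ i / L)\<^sup>2 < M\<^sup>2" by (metis abs_le_square_iff not_le)
      then show ?thesis using that w by (simp add: support_def)
    qed
    moreover
    \<comment> \<open>Strictness on both sides needs a threshold below the square of \<open>M\<close>.\<close>
    obtain \<tau> where "0 \<le> \<tau>" "\<tau> < M\<^sup>2" "\<And>i. i \<notin> support xs \<Longrightarrow> (w $ i)\<^sup>2 < \<tau>"
    proof -
      define q where "q = Max (insert 0 ((\<lambda>i. (w $ i)\<^sup>2) ` (- support xs)))"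
      have "q < M\<^sup>2" unfolding q_def using small \<open>M > 0\<close> by (subst Max_less_iff) auto
      then obtain \<tau> where "q < \<tau>" "\<tau> < M\<^sup>2" using dense by blast
      moreover have "0 \<le> q" unfolding q_def by (rule Max_ge) auto
      moreover have "(w $ i)\<^sup>2 \<le> q" if "i \<notin> support xs" for i
        unfolding q_def using that by (intro Max_ge) auto
      ultimately show ?thesis using that by (meson le_less_trans less_imp_le)
    qed
    ultimately show ?thesis
      using \<open>l0norm u \<le> s\<close> \<open>u \<noteq> xs\<close> full
      by (intro hard_threshold_strict[of xs w \<tau>]) (use less_le_trans in blast)+
  next
    case False
    then have "card (insert i (support xs)) \<le> s" for i
      using card_s by (simp add: card_insert_if)
    then have "g $ i = 0" for i by (rule g_zero)
    then have "w = xs" using w by (simp add: vec_eq_iff)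
    then show ?thesis using \<open>u \<noteq> xs\<close> by simp
  qed
qed

text \<open>With \<open>x\<close> fixed the objective is a quadratic in \<open>y\<close> whose curvature is at most
  \<^const>\<open>lambda_max\<close>, less than \<open>L\<close>. Hence any other \<open>y\<close> at least as close to the gradient step as
  \<open>ys\<close> would have a smaller objective value.\<close>

lemma minimizer_snd_unique_projection:
  assumes opt: "is_arg_min (objective A b) (\<lambda>z. z \<in> feasible s t) (xs, ys)"
    and curv: "lambda_max (transpose (tensor_mult2 A xs) ** tensor_mult2 A xs) < L"
    and w_def: "w = ys - (1 / L) *\<^sub>R snd (gradient (objective A b) (xs, ys))"
    and "l0norm y \<le> t" "y \<noteq> ys"
  shows "(norm (ys - w))\<^sup>2 < (norm (y - w))\<^sup>2"
proof -
  let ?lam = "lambda_max (transpose (tensor_mult2 A xs) ** tensor_mult2 A xs)"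
  define g where "g = snd (gradient (objective A b) (xs, ys))"
  define h where "h = y - ys"
  have "0 \<le> ?lam" by (rule norm_matrix_vector_le_lambda_max(2))
  then have "0 < L" using curv by linarith
  have "(xs, y) \<in> feasible s t"
    using opt \<open>l0norm y \<le> t\<close> by (simp add: is_arg_min_def feasible_def F2_def)
  then have "objective A b (xs, ys) \<le> objective A b (xs, ys + h)"
    using opt unfolding is_arg_min_def h_def by (simp add: not_less)
  then have "0 \<le> h \<bullet> g + (1/2) * (norm (tensor_mult2 A xs *v h))\<^sup>2"
    unfolding objective_expand_snd g_def tensor_mult_eq_tensor_mult2 by linarith
  also have "(norm (tensor_mult2 A xs *v h))\<^sup>2 \<le> ?lam * (norm h)\<^sup>2"
    by (rule norm_matrix_vector_le_lambda_max(1))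
  also have "?lam * (norm h)\<^sup>2 < L * (norm h)\<^sup>2"
    using curv \<open>y \<noteq> ys\<close> unfolding h_def by simp
  finally have "0 < (2 / L) * (h \<bullet> g) + (norm h)\<^sup>2"
    using \<open>0 < L\<close> by (simp add: field_simps)
  moreover have "y - w = h + (1 / L) *\<^sub>R g" "ys - w = (1 / L) *\<^sub>R g"
    unfolding h_def w_def g_def by simp_all
  ultimately show ?thesis
    by (simp only: power2_norm_eq_inner) (simp add: inner_add inner_commute algebra_simps)
qed

section \<open>The like-projection\<close>

text \<open>The map \<^const>\<open>psi\<close> only rescales the two blocks of a feasible point, so its image consists
  of sparse pairs. If \<open>z\<close> has \<open>(xs, ys)\<close> as its strict best approximation among these blockwise,
  then the rescaling leads to \<open>(xs, ys)\<close> from no other normalized point.\<close>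

lemma like_proj_eq_singleton:
  assumes feas: "(xs, ys) \<in> feasible s t"
    and on: "\<And>i. i \<in> support xs \<Longrightarrow> fst z $ i = xs $ i"
    and projx: "\<And>u. l0norm u \<le> s \<Longrightarrow> u \<noteq> xs \<Longrightarrow> (norm (xs - fst z))\<^sup>2 < (norm (u - fst z))\<^sup>2"
    and projy: "\<And>y. l0norm y \<le> t \<Longrightarrow> y \<noteq> ys \<Longrightarrow> (norm (ys - snd z))\<^sup>2 < (norm (y - snd z))\<^sup>2"
  shows "like_proj (feasible s t) z = {(xs, ys)}"
proof -
  have xs: "xs \<noteq> 0" "xs $ first_nz xs = 1"
    using feas by (auto simp: feasible_def F1_def)
  have sub: "support xs \<subseteq> support (fst z)" using on by (auto simp: support_def)
  then have first_in: "first_nz xs \<in> support (fst z)" using first_nz_in_support[OF xs(1)] by blast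
  then have "fst z \<noteq> 0" by (auto simp: support_def)
  have psi_eq: "psi z u = (c *\<^sub>R fst u, (1 / c) *\<^sub>R snd u)" if "c = fst z $ gamma_like z u" for u c
    using \<open>fst z \<noteq> 0\<close> that by (simp add: psi_def Let_def scaleR_vec_def divide_inverse mult.commute)
  have "gamma_like z (xs, ys) = first_nz xs"
    using sub by (simp add: gamma_like_def first_nz_def Int_absorb2)
  then have psi_opt: "psi z (xs, ys) = (xs, ys)"
    using on[OF first_nz_in_support[OF xs(1)]] xs by (subst psi_eq[of 1]) simp_all
  have def_opt: "psi_defined z (xs, ys)"
    using first_in first_nz_in_support[OF xs(1)] by (auto simp: psi_defined_def)
  have norm_split: "(norm (p - z))\<^sup>2 = (norm (fst p - fst z))\<^sup>2 + (norm (snd p - snd z))\<^sup>2" for p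
    by (simp add: norm_prod_def)
  have better: "(norm (psi z (xs, ys) - z))\<^sup>2 < (norm (psi z u - z))\<^sup>2"
    if u: "u \<in> feasible s t" "psi_defined z u" "u \<noteq> (xs, ys)" for u
  proof -
    define c where "c = fst z $ gamma_like z u"
    have "gamma_like z u \<in> support (fst u) \<inter> support (fst z)"
      unfolding gamma_like_def using u(2) \<open>fst z \<noteq> 0\<close> by (intro Min_in) (auto simp: psi_defined_def)
    then have "c \<noteq> 0" unfolding c_def by (simp add: support_def)
    have u1: "l0norm (fst u) \<le> s" "fst u $ first_nz (fst u) = 1" "l0norm (snd u) \<le> t"
      using u(1) by (auto simp: feasible_def F1_def F2_def)
    have sparse: "l0norm (fst (psi z u)) \<le> s" "l0norm (snd (psi z u)) \<le> t"
      using u1 \<open>c \<noteq> 0\<close> by (simp_all add: psi_eq[OF c_def])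
    have "psi z u \<noteq> (xs, ys)"
    proof
      assume "psi z u = (xs, ys)"
      then have eqs: "c *\<^sub>R fst u = xs" "(1 / c) *\<^sub>R snd u = ys" by (simp_all add: psi_eq[OF c_def])
      then have "first_nz (fst u) = first_nz xs"
        unfolding first_nz_def using \<open>c \<noteq> 0\<close> by (metis support_scaleR)
      \<comment> \<open>Both first nonzero entries are 1, so the scalar is.\<close>
      then have "c = 1" using eqs(1) u1(2) xs(2) by (metis mult.right_neutral real_scaleR_def vector_scaleR_component)
      then show False using eqs u(3) by (simp add: prod_eq_iff)
    qed
    then have "fst (psi z u) \<noteq> xs \<or> snd (psi z u) \<noteq> ys" by (auto simp: prod_eq_iff)
    moreover have "(norm (xs - fst z))\<^sup>2 \<le> (norm (fst (psi z u) - fst z))\<^sup>2"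
      using projx[OF sparse(1)] by (metis less_imp_le order_refl)
    moreover have "(norm (ys - snd z))\<^sup>2 \<le> (norm (snd (psi z u) - snd z))\<^sup>2"
      using projy[OF sparse(2)] by (metis less_imp_le order_refl)
    ultimately show ?thesis
      using projx[OF sparse(1)] projy[OF sparse(2)]
      unfolding psi_opt norm_split fst_conv snd_conv by linarith
  qed
  show ?thesis
  proof (intro equalityI subsetI)
    fix u assume "u \<in> like_proj (feasible s t) z"
    then show "u \<in> {(xs, ys)}"
      using better feas def_opt unfolding like_proj_def is_arg_min_def by blast
  next
    fix u assume "u \<in> {(xs, ys)}"
    then show "u \<in> like_proj (feasible s t) z"
      using better feas def_opt unfolding like_proj_def is_arg_min_def
      by simp (metis less_asym less_irrefl)
  qed
qed

theorem theorem3p16: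
  fixes A :: "real^'n^('m::{finite,linorder})^'l"
    and b :: "real^'l"
    and s t :: nat
    and L :: real
    and xs :: "real^('m::{finite,linorder})" and ys :: "real^'n"
  assumes "0 < s" "s < CARD('m)" "0 < t" "t < CARD('n)"
    and "is_arg_min (objective A b) (\<lambda>z. z \<in> feasible s t) (xs, ys)"
    and "fst (gradient (objective A b) (xs, ys)) $ first_nz xs = 0"
    and "ereal L >
           max (ereal (lambda_max (transpose (tensor_mult2 A xs) ** tensor_mult2 A xs)))
               (Max ((\<lambda>i. ereal \<bar>fst (gradient (objective A b) (xs, ys)) $ i\<bar>
                            / ereal (ith_largest s \<bar>xs\<bar>)) ` (UNIV - support xs)))"
  shows "like_stationary (feasible s t) (objective A b) L (xs, ys) \<and>
         like_proj (feasible s t)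
             ((xs, ys) - (1 / L) *\<^sub>R gradient (objective A b) (xs, ys)) = {(xs, ys)}"
proof -
  let ?g = "gradient (objective A b) (xs, ys)"
  define z where "z = (xs, ys) - (1 / L) *\<^sub>R ?g"
  note opt = assms(5)
  have feas: "(xs, ys) \<in> feasible s t" using opt by (simp add: is_arg_min_def)
  have curv: "lambda_max (transpose (tensor_mult2 A xs) ** tensor_mult2 A xs) < L"
    using assms(7) by simp
  then have "0 < L" using norm_matrix_vector_le_lambda_max(2)[of "tensor_mult2 A xs"] by linarith
  have quot: "ereal \<bar>fst ?g $ i\<bar> / ereal (ith_largest s \<bar>xs\<bar>) < ereal L" if "i \<notin> support xs" for i
  proof (rule le_less_trans[OF Max_ge])
    show "ereal \<bar>fst ?g $ i\<bar> / ereal (ith_largest s \<bar>xs\<bar>)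
        \<in> (\<lambda>i. ereal \<bar>fst ?g $ i\<bar> / ereal (ith_largest s \<bar>xs\<bar>)) ` (UNIV - support xs)"
      using that by blast
  qed (use assms(7) in auto)
  have "fst ?g $ i = 0" if "i \<in> support xs" for i
  proof -
    have "card (insert i (support xs)) \<le> s"
      using feas that by (auto simp: insert_absorb feasible_def F1_def l0norm_def)
    then show ?thesis by (rule minimizer_partial_zero[OF opt assms(6)])
  qed
  then have "\<And>i. i \<in> support xs \<Longrightarrow> fst z $ i = xs $ i" unfolding z_def by simp
  moreover have "fst z = xs - (1 / L) *\<^sub>R fst ?g" "snd z = ys - (1 / L) *\<^sub>R snd ?g"
    unfolding z_def by simp_all
  ultimately have "like_proj (feasible s t) z = {(xs, ys)}"
    using minimizer_fst_unique_projection[OF opt assms(6,1,2) \<open>0 < L\<close> quot]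
      minimizer_snd_unique_projection[OF opt curv] feas
    by (intro like_proj_eq_singleton) auto
  then show ?thesis
    using feas \<open>0 < L\<close> assms(6) unfolding like_stationary_def z_def by simp
qed

end
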